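(* Let $\varphi_1>0$ and let $f \in C^1[\varphi_1,\infty)$ be a real-valued function with $\lim_{\varphi\to\infty} f(\varphi)=0$. Assume that there exist positive constants $\underline{m}$, $K$ and $\alpha \in(0,1)$ such that, for all $\varphi \ge \varphi_1$, $$\underline{m}\, \varphi^{-\alpha} \le f(\varphi), \qquad - K \varphi^{-\alpha-1} \le f'(\varphi) \le 0.$$ Assume, moreover, that for each fixed $\varphi \ge \varphi_1$ the function $f'$ is not identically zero on $[\varphi,\varphi+2\pi)$. Let $\Gamma= \{ (f(\varphi)\cos \varphi,f(\varphi)\sin \varphi) : \varphi \ge \varphi_1 \}$. Then $\dim_{\rm B} \Gamma = \dfrac{2}{1+\alpha}$.
   Context: For a bounded set $\Gamma\subset\mathbf{R}^2$, the box-counting (Minkowski-Bouligand) dimension is $$\dim_{\rm B} \Gamma = 2 - \lim_{\varepsilon \to +0} \frac{\log|\Gamma_\varepsilon|}{\log \varepsilon},$$ where $\Gamma_\varepsilon = \{ (x,y) \in \mathbf{R}^2 : d((x,y),\Gamma) \le \varepsilon \}$, $d$ is the Euclidean distance, and $|\Gamma_\varepsilon|$ is the two-dimensional Lebesgue measure of $\Gamma_\varepsilon$. The assertion $\dim_{\rm B}\Gamma=d$ includes that the limit exists. *)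

theory Defs
  imports "HOL-Analysis.Analysis"
begin

definition eps_nbhd :: "(real \<times> real) set \<Rightarrow> real \<Rightarrow> (real \<times> real) set" where
  "eps_nbhd \<Gamma> \<epsilon> = {p. infdist p \<Gamma> \<le> \<epsilon>}"

text \<open>
  A predicate rather than a function, so that asserting \<open>has_box_dim \<Gamma> d\<close> includes the existence
  of the limit. The dimension is considered only for bounded nonempty sets: then the
  neighbourhoods have finite positive measure, so the total functions \<^const>\<open>measure\<close> and
  \<^const>\<open>ln\<close> are used only where they have their usual meaning (the library sets
  \<open>infdist p {} = 0\<close>, infinite measures to \<open>0\<close> and \<open>ln 0 = 0\<close>).
\<close>
definition has_box_dim :: "(real \<times> real) set \<Rightarrow> real \<Rightarrow> bool" where
  "has_box_dim \<Gamma> d \<longleftrightarrow> bounded \<Gamma> \<and> \<Gamma> \<noteq> {} \<and>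
     (\<exists>L. ((\<lambda>\<epsilon>. ln (measure lebesgue (eps_nbhd \<Gamma> \<epsilon>)) / ln \<epsilon>) \<longlongrightarrow> L) (at_right 0) \<and> d = 2 - L)"

end

theory Submission
  imports Defs "HOL-Real_Asymp.Real_Asymp"
begin

text \<open>
  Let \<open>\<Phi>\<close> be of order \<open>\<epsilon> powr (- 1 / (1 + \<alpha>))\<close>. Consecutive turns beyond the angle \<open>\<Phi>\<close> are
  at distance at most \<open>\<epsilon>\<close>, so the neighbourhood contains a disc of radius of order
  \<open>\<Phi> powr (- \<alpha>) = \<epsilon> powr (\<alpha> / (1 + \<alpha>))\<close>. Conversely it is covered by a disc of comparable radius
  and the neighbourhood of the arc up to \<open>\<Phi>\<close>, whose length is \<open>O(\<Phi> powr (1 - \<alpha>))\<close> and whose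
  neighbourhood therefore has area \<open>O(\<epsilon> * \<Phi> powr (1 - \<alpha>)) = O(\<epsilon> powr (2 * \<alpha> / (1 + \<alpha>)))\<close>.
  Hence the area of the neighbourhood is of order \<open>\<epsilon> powr (2 * \<alpha> / (1 + \<alpha>))\<close>.
\<close>

section \<open>Box dimension from two-sided power bounds on the area\<close>

text \<open>A multiplicative constant \<open>c\<close> adds only \<open>ln c / ln \<epsilon>\<close>
  to the quotient, and this tends to 0, so both bounds squeeze it to \<open>s\<close>. Since
  \<open>ln \<epsilon> < 0\<close> for \<open>\<epsilon> < 1\<close>, division reverses the
  inequalities: the upper area bound yields the lower bound of the quotient, and conversely.\<close>

lemma has_box_dimI:
  fixes \<Gamma> :: "(real \<times> real) set"
  assumes "bounded \<Gamma>" "\<Gamma> \<noteq> {}" and c: "c\<^sub>1 > 0" "c\<^sub>2 > 0"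
    and lower: "eventually (\<lambda>\<epsilon>. c\<^sub>1 * \<epsilon> powr s \<le> measure lebesgue (eps_nbhd \<Gamma> \<epsilon>)) (at_right 0)"
    and upper: "eventually (\<lambda>\<epsilon>. measure lebesgue (eps_nbhd \<Gamma> \<epsilon>) \<le> c\<^sub>2 * \<epsilon> powr s) (at_right 0)"
  shows "has_box_dim \<Gamma> (2 - s)"
proof -
  let ?A = "\<lambda>\<epsilon>. measure lebesgue (eps_nbhd \<Gamma> \<epsilon>)"
  have lim: "((\<lambda>\<epsilon>. (ln c + s * ln \<epsilon>) / ln \<epsilon>) \<longlongrightarrow> s) (at_right 0)" for c :: real
    by real_asymp
  have small: "eventually (\<lambda>\<epsilon>::real. 0 < \<epsilon> \<and> \<epsilon> < 1) (at_right 0)"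
    using eventually_at_right_field[of "\<lambda>\<epsilon>::real. 0 < \<epsilon> \<and> \<epsilon> < 1" 0] zero_less_one by blast
  have le: "eventually (\<lambda>\<epsilon>. (ln c\<^sub>2 + s * ln \<epsilon>) / ln \<epsilon> \<le> ln (?A \<epsilon>) / ln \<epsilon>) (at_right 0)"
    using small lower upper
  proof eventually_elim
    case (elim \<epsilon>)
    have "0 < c\<^sub>1 * \<epsilon> powr s" using c elim by simp
    then have "ln (?A \<epsilon>) \<le> ln (c\<^sub>2 * \<epsilon> powr s)" using elim by (intro ln_mono) linarith+
    also have "\<dots> = ln c\<^sub>2 + s * ln \<epsilon>" using c elim by (simp add: ln_mult ln_powr)
    finally show ?case using elim by (intro divide_right_mono_neg) auto
  qed
  have ge: "eventually (\<lambda>\<epsilon>. ln (?A \<epsilon>) / ln \<epsilon> \<le> (ln c\<^sub>1 + s * ln \<epsilon>) / ln \<epsilon>) (at_right 0)"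
    using small lower
  proof eventually_elim
    case (elim \<epsilon>)
    have "0 < c\<^sub>1 * \<epsilon> powr s" using c elim by simp
    then have "ln (c\<^sub>1 * \<epsilon> powr s) \<le> ln (?A \<epsilon>)" using elim by (intro ln_mono) linarith+
    moreover have "ln (c\<^sub>1 * \<epsilon> powr s) = ln c\<^sub>1 + s * ln \<epsilon>" using c elim by (simp add: ln_mult ln_powr)
    ultimately show ?case using elim by (intro divide_right_mono_neg) auto
  qed
  have "((\<lambda>\<epsilon>. ln (?A \<epsilon>) / ln \<epsilon>) \<longlongrightarrow> s) (at_right 0)"
    by (rule tendsto_sandwich[OF le ge lim lim])
  then show ?thesis using assms(1,2) unfolding has_box_dim_def by auto
qed

lemma eps_nbhdI: "q \<in> \<Gamma> \<Longrightarrow> dist p q \<le> \<epsilon> \<Longrightarrow> p \<in> eps_nbhd \<Gamma> \<epsilon>"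
  unfolding eps_nbhd_def using infdist_le2 by auto

text \<open>The infimum defining the distance need not be attained, because the set is not assumed
  closed. Doubling the radius makes the inequality strict and so provides an actual point; the
  factor affects only constants.\<close>

lemma eps_nbhdE:
  assumes "p \<in> eps_nbhd \<Gamma> \<epsilon>" "\<epsilon> > 0" "\<Gamma> \<noteq> {}"
  obtains q where "q \<in> \<Gamma>" "dist p q \<le> 2 * \<epsilon>"
proof -
  have "(INF q\<in>\<Gamma>. dist p q) < 2 * \<epsilon>" using assms by (auto simp: eps_nbhd_def infdist_def)
  then show ?thesis using that assms(3)
    by (subst (asm) cINF_less_iff) (auto intro: less_imp_le)
qed

lemma closed_eps_nbhd: "closed (eps_nbhd \<Gamma> \<epsilon>)"
  unfolding eps_nbhd_def by (intro closed_Collect_le continuous_intros)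

lemma lmeasurable_eps_nbhd:
  assumes "bounded \<Gamma>" "\<Gamma> \<noteq> {}" "\<epsilon> > 0"
  shows "eps_nbhd \<Gamma> \<epsilon> \<in> lmeasurable"
proof -
  obtain B where B: "\<And>q. q \<in> \<Gamma> \<Longrightarrow> norm q \<le> B" using assms(1) by (auto simp: bounded_iff)
  have "norm p \<le> B + 2 * \<epsilon>" if p: "p \<in> eps_nbhd \<Gamma> \<epsilon>" for p
  proof -
    obtain q where "q \<in> \<Gamma>" "dist p q \<le> 2 * \<epsilon>" by (rule eps_nbhdE[OF p assms(3,2)])
    then show ?thesis using B[of q] norm_triangle_sub[of p q] by (simp add: dist_norm)
  qed
  then have "bounded (eps_nbhd \<Gamma> \<epsilon>)" unfolding bounded_iff by blast
  then show ?thesis using closed_eps_nbhd by (intro lmeasurable_compact) (simp add: compact_eq_bounded_closed)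
qed

lemma content_cball_plane:
  fixes c :: "real \<times> real"
  assumes "r \<ge> 0"
  shows "measure lborel (cball c r) = pi * r\<^sup>2"
  using content_cball[OF assms, of c] by (simp add: unit_ball_vol_2 power2_eq_square)

section \<open>Monotonicity on a half-line\<close>

lemma has_derivative_nonneg_imp_le:
  fixes g g' :: "real \<Rightarrow> real"
  assumes deriv: "\<And>x. x \<ge> a \<Longrightarrow> (g has_real_derivative g' x) (at x within {a..})"
    and "\<And>x. x \<ge> a \<Longrightarrow> g' x \<ge> 0" and "a \<le> x" "x \<le> y"
  shows "g x \<le> g y"
proof (cases "x = y")
  case False
  have "(g has_derivative (\<lambda>h. g' z * h)) (at z within {x..y})" if "x \<le> z" "z \<le> y" for z
    using has_field_derivative_subset[OF deriv, of z "{x..y}"] that assms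
    by (auto simp: has_field_derivative_def)
  then obtain z where "z \<in> {x<..<y}" "g y - g x = g' z * (y - x)"
    using mvt_simple[of x y g "\<lambda>z h. g' z * h"] False assms by auto
  then show ?thesis using assms(2)[of z] assms(3,4) by (smt (verit) greaterThanLessThan_iff mult_nonneg_nonneg)
qed simp

text \<open>Both \<open>h - g\<close> and \<open>h + g\<close> have nonnegative derivative, hence
  are nondecreasing. This replaces estimating the integral of \<open>g'\<close> by that of
  \<open>h'\<close>.\<close>

lemma has_derivative_abs_le_imp_abs_diff_le:
  fixes g h g' h' :: "real \<Rightarrow> real"
  assumes "\<And>x. x \<ge> a \<Longrightarrow> (g has_real_derivative g' x) (at x within {a..})"
    and "\<And>x. x \<ge> a \<Longrightarrow> (h has_real_derivative h' x) (at x within {a..})"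
    and bound: "\<And>x. x \<ge> a \<Longrightarrow> \<bar>g' x\<bar> \<le> h' x" and "a \<le> x" "x \<le> y"
  shows "\<bar>g y - g x\<bar> \<le> h y - h x"
proof -
  have "h x - g x \<le> h y - g y"
  proof (rule has_derivative_nonneg_imp_le[where g = "\<lambda>x. h x - g x" and a = a])
    show "((\<lambda>x. h x - g x) has_real_derivative h' z - g' z) (at z within {a..})" if "z \<ge> a" for z
      using that by (intro DERIV_diff assms(1,2))
    show "0 \<le> h' z - g' z" if "z \<ge> a" for z using bound[OF that] by linarith
  qed (use assms(4,5) in auto)
  moreover have "h x + g x \<le> h y + g y"
  proof (rule has_derivative_nonneg_imp_le[where g = "\<lambda>x. h x + g x" and a = a])
    show "((\<lambda>x. h x + g x) has_real_derivative h' z + g' z) (at z within {a..})" if "z \<ge> a" for z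
      using that by (intro DERIV_add assms(1,2))
    show "0 \<le> h' z + g' z" if "z \<ge> a" for z using bound[OF that] by linarith
  qed (use assms(4,5) in auto)
  ultimately show ?thesis by linarith
qed

section \<open>Polar coordinates in the plane\<close>

definition spiral :: "(real \<Rightarrow> real) \<Rightarrow> real \<Rightarrow> real \<times> real" where
  "spiral f \<phi> = (f \<phi> * cos \<phi>, f \<phi> * sin \<phi>)"

lemma dist_polar: "dist (r * cos t, r * sin t) (r' * cos t, r' * sin t) = \<bar>r - r'\<bar>"
proof -
  have "(r * cos t - r' * cos t)\<^sup>2 + (r * sin t - r' * sin t)\<^sup>2
      = (r - r')\<^sup>2 * ((sin t)\<^sup>2 + (cos t)\<^sup>2)"
    by algebra
  then show ?thesis by (simp add: dist_Pair_Pair dist_real_def)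
qed

lemma norm_spiral: "norm (spiral f \<phi>) = \<bar>f \<phi>\<bar>"
  using dist_polar[of "f \<phi>" \<phi> 0] by (simp add: spiral_def dist_norm)

text \<open>Adding \<open>n\<close> full turns to the principal argument moves it into any closed
  window of length \<open>2 * pi\<close>. The origin is included, with radius 0.\<close>

lemma polar_above:
  fixes p :: "real \<times> real"
  obtains \<phi> where "p = (norm p * cos \<phi>, norm p * sin \<phi>)" "\<Phi> \<le> \<phi>" "\<phi> \<le> \<Phi> + 2 * pi"
proof -
  define z where "z = Complex (fst p) (snd p)"
  define t where "t = Arg z"
  define n where "n = \<lceil>(\<Phi> - t) / (2 * pi)\<rceil>"
  define \<phi> where "\<phi> = t + 2 * pi * of_int n"
  have norm: "norm p = cmod z" by (simp add: z_def norm_prod_def cmod_def)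
  have "z = rcis (cmod z) t" by (simp add: t_def rcis_cmod_Arg)
  then have "p = (norm p * cos t, norm p * sin t)"
    unfolding norm by (metis Re_rcis Im_rcis z_def complex.sel prod.collapse)
  moreover have "cos \<phi> = cos t" "sin \<phi> = sin t"
    by (simp_all add: \<phi>_def cos_add sin_add)
  moreover have "(\<Phi> - t) / (2 * pi) \<le> n" "n \<le> (\<Phi> - t) / (2 * pi) + 1"
    unfolding n_def by linarith+
  then have "\<Phi> \<le> \<phi>" "\<phi> \<le> \<Phi> + 2 * pi"
    by (simp_all add: \<phi>_def field_simps)
  ultimately show ?thesis using that by metis
qed

section \<open>Decay of the radius and of the gaps between turns\<close>

locale power_spiral =
  fixes f f' :: "real \<Rightarrow> real" and a m K \<alpha> :: real
  assumes a_pos: "a > 0"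
    and deriv: "\<And>\<phi>. \<phi> \<ge> a \<Longrightarrow> (f has_real_derivative f' \<phi>) (at \<phi> within {a..})"
    and lim: "(f \<longlongrightarrow> 0) at_top"
    and m_pos: "m > 0" and K_pos: "K > 0" and \<alpha>_pos: "0 < \<alpha>" and \<alpha>_less: "\<alpha> < 1"
    and f_ge: "\<And>\<phi>. \<phi> \<ge> a \<Longrightarrow> m * \<phi> powr (- \<alpha>) \<le> f \<phi>"
    and f'_ge: "\<And>\<phi>. \<phi> \<ge> a \<Longrightarrow> - K * \<phi> powr (- \<alpha> - 1) \<le> f' \<phi>"
    and f'_le: "\<And>\<phi>. \<phi> \<ge> a \<Longrightarrow> f' \<phi> \<le> 0"
begin

abbreviation \<Gamma> :: "(real \<times> real) set" where "\<Gamma> \<equiv> spiral f ` {a..}"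

lemma f_pos: "\<phi> \<ge> a \<Longrightarrow> f \<phi> > 0"
  using f_ge[of \<phi>] m_pos a_pos by (smt (verit) mult_pos_pos powr_gt_zero)

lemma f_antimono: "a \<le> x \<Longrightarrow> x \<le> y \<Longrightarrow> f y \<le> f x"
  using has_derivative_nonneg_imp_le[of a "\<lambda>x. - f x" "\<lambda>x. - f' x" x y] f'_le
  by (auto intro!: derivative_intros deriv)

lemma deriv_powr:
  "x \<ge> a \<Longrightarrow> ((\<lambda>x. x powr b) has_real_derivative b * x powr (b - 1)) (at x within {a..})"
  using a_pos by (auto intro!: derivative_eq_intros DERIV_subset[OF has_real_derivative_powr])

text \<open>This is the derivative bound integrated from \<open>\<phi>\<close> to infinity:
  \<open>?g\<close> is nondecreasing and tends to 0, so it is nowhere positive. Together with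
  \<open>f_ge\<close> it fixes the order of \<open>f\<close>.\<close>

lemma f_le:
  assumes "\<phi> \<ge> a"
  shows "f \<phi> \<le> K / \<alpha> * \<phi> powr (- \<alpha>)"
proof -
  let ?g = "\<lambda>x. f x - K / \<alpha> * x powr (- \<alpha>)"
  have "?g \<phi> \<le> ?g x" if "\<phi> \<le> x" for x
  proof (rule has_derivative_nonneg_imp_le[where a = a and g = ?g
        and g' = "\<lambda>x. f' x - K / \<alpha> * (- \<alpha> * x powr (- \<alpha> - 1))"])
    show "(?g has_real_derivative f' x - K / \<alpha> * (- \<alpha> * x powr (- \<alpha> - 1))) (at x within {a..})"
      if "x \<ge> a" for x
      using that by (intro DERIV_diff DERIV_cmult deriv deriv_powr)
    show "0 \<le> f' x - K / \<alpha> * (- \<alpha> * x powr (- \<alpha> - 1))" if "x \<ge> a" for x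
      using f'_ge[OF that] \<alpha>_pos by simp
  qed (use assms that in auto)
  moreover have "(?g \<longlongrightarrow> 0 - K / \<alpha> * 0) at_top"
    using \<alpha>_pos by (intro tendsto_intros lim tendsto_neg_powr filterlim_ident) auto
  ultimately have "?g \<phi> \<le> 0"
    using tendsto_lowerbound[of ?g 0 at_top "?g \<phi>"] eventually_mono[OF eventually_ge_at_top[of \<phi>]]
    by simp
  then show ?thesis by simp
qed

text \<open>On the half-line from \<open>\<Phi>\<close> the derivative is at least
  \<open>- ?c\<close>, so \<open>f x + ?c * x\<close> is nondecreasing there; comparing its values
  one turn apart gives the gap.\<close>

lemma f_turn_le:
  assumes "a \<le> \<Phi>" "\<Phi> \<le> \<phi>"
  shows "f \<phi> - f (\<phi> + 2 * pi) \<le> 2 * pi * K * \<Phi> powr (- \<alpha> - 1)"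
proof -
  let ?c = "K * \<Phi> powr (- \<alpha> - 1)"
  have "f \<phi> + ?c * \<phi> \<le> f (\<phi> + 2 * pi) + ?c * (\<phi> + 2 * pi)"
  proof (rule has_derivative_nonneg_imp_le[where a = \<Phi> and g = "\<lambda>x. f x + ?c * x" and g' = "\<lambda>x. f' x + ?c * 1"])
    show "((\<lambda>x. f x + ?c * x) has_real_derivative f' x + ?c * 1) (at x within {\<Phi>..})" if "x \<ge> \<Phi>" for x
      using that assms
      by (intro DERIV_add DERIV_cmult DERIV_ident has_field_derivative_subset[OF deriv]) auto
    show "0 \<le> f' x + ?c * 1" if "x \<ge> \<Phi>" for x
    proof -
      have "x powr (- \<alpha> - 1) \<le> \<Phi> powr (- \<alpha> - 1)"
        using that assms a_pos \<alpha>_pos by (intro powr_mono2') auto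
      then have "K * x powr (- \<alpha> - 1) \<le> ?c" using K_pos by simp
      then show ?thesis using f'_ge[of x] that assms by simp
    qed
  qed (use assms in auto)
  then show ?thesis by (simp add: algebra_simps)
qed

lemma bounded_\<Gamma>: "bounded \<Gamma>"
  unfolding bounded_iff using f_antimono f_pos
  by (intro exI[of _ "f a"]) (fastforce simp: norm_spiral abs_of_pos)

section \<open>Lower bound on the area\<close>

text \<open>Along the ray through a given point, the spiral passes at radii that decrease to 0 in
  steps of at most \<open>\<epsilon>\<close>, starting no lower than the radius of the disc. Hence
  one of these crossings is within \<open>\<epsilon>\<close> of the point.\<close>

lemma cball_subset_eps_nbhd:
  assumes "a \<le> \<Phi>" and turn: "2 * pi * K * \<Phi> powr (- \<alpha> - 1) \<le> \<epsilon>" and "\<epsilon> > 0"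
  shows "cball 0 (f (\<Phi> + 2 * pi)) \<subseteq> eps_nbhd \<Gamma> \<epsilon>"
proof
  fix p :: "real \<times> real" assume "p \<in> cball 0 (f (\<Phi> + 2 * pi))"
  then have p_le: "norm p \<le> f (\<Phi> + 2 * pi)" by simp
  obtain \<phi> where p: "p = (norm p * cos \<phi>, norm p * sin \<phi>)" and \<phi>: "\<Phi> \<le> \<phi>" "\<phi> \<le> \<Phi> + 2 * pi"
    by (rule polar_above)
  define \<psi> where "\<psi> n = \<phi> + 2 * pi * real n" for n
  have cs: "cos (\<psi> n) = cos \<phi>" "sin (\<psi> n) = sin \<phi>" for n
    using cos_int_2pin[of "int n"] sin_int_2pin[of "int n"] by (simp_all add: \<psi>_def cos_add sin_add)
  have \<psi>_ge: "\<Phi> \<le> \<psi> n" for n using \<phi> by (simp add: \<psi>_def add_increasing2)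
  have "filterlim \<psi> at_top sequentially" unfolding \<psi>_def by real_asymp
  then have lim_\<psi>: "(\<lambda>n. f (\<psi> n)) \<longlonglongrightarrow> 0" using lim by (rule filterlim_compose[rotated])
  have "\<exists>n. \<bar>f (\<psi> n) - norm p\<bar> \<le> \<epsilon>"
  \<comment> \<open>The crossing radii are positive and never drop below 0, so the origin is reached
    only through their limit.\<close>
  proof (cases "p = 0")
    case True
    have "eventually (\<lambda>n. \<bar>f (\<psi> n)\<bar> < \<epsilon>) sequentially"
      using tendstoD[OF lim_\<psi> \<open>\<epsilon> > 0\<close>] by (simp add: dist_real_def)
    then show ?thesis using True by (auto simp: eventually_sequentially intro: less_imp_le)
  next
    case False
    have "\<exists>n. f (\<psi> n) < norm p"
      using order_tendstoD(2)[OF lim_\<psi>, of "norm p"] False by (auto simp: eventually_sequentially)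
    moreover have "norm p \<le> f (\<psi> 0)"
      using p_le f_antimono[of \<phi> "\<Phi> + 2 * pi"] \<phi> assms(1) by (simp add: \<psi>_def)
    \<comment> \<open>The norm lies between the radii of two consecutive crossings, the second being
      the first one below it.\<close>
    ultimately obtain n where n: "norm p \<le> f (\<psi> n)" "f (\<psi> (Suc n)) < norm p"
      using ex_least_nat_less[of "\<lambda>n. f (\<psi> n) < norm p"] by (metis not_le order_refl)
    have "\<psi> (Suc n) = \<psi> n + 2 * pi" by (simp add: \<psi>_def algebra_simps)
    then have "f (\<psi> n) - f (\<psi> (Suc n)) \<le> \<epsilon>"
      using f_turn_le[OF assms(1) \<psi>_ge[of n]] turn by simp
    then show ?thesis using n by (intro exI[of _ n]) linarith
  qed
  then obtain n where "\<bar>f (\<psi> n) - norm p\<bar> \<le> \<epsilon>" ..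
  moreover have "dist p (spiral f (\<psi> n)) = \<bar>f (\<psi> n) - norm p\<bar>"
    unfolding spiral_def cs by (subst p) (simp add: dist_polar)
  ultimately show "p \<in> eps_nbhd \<Gamma> \<epsilon>"
    using \<psi>_ge[of n] assms(1) by (intro eps_nbhdI[of "spiral f (\<psi> n)"]) auto
qed

lemma measure_lower:
  obtains c where "c > 0"
    "eventually (\<lambda>\<epsilon>. c * \<epsilon> powr (2 * \<alpha> / (1 + \<alpha>)) \<le> measure lebesgue (eps_nbhd \<Gamma> \<epsilon>)) (at_right 0)"
proof
  define \<beta> where "\<beta> = 1 / (1 + \<alpha>)"
  have \<beta>: "\<beta> > 0" "\<beta> * (1 + \<alpha>) = 1" using \<alpha>_pos by (auto simp: \<beta>_def)
  define b where "b = 2 * pi * K"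
  have b: "b > 0" using K_pos by (simp add: b_def)
  \<comment> \<open>This is the constant left when \<open>m * (2 * \<Phi>) powr (- \<alpha>)\<close>
    is expressed in \<open>\<epsilon>\<close> for the angle \<open>\<Phi>\<close> chosen
    below.\<close>
  define d where "d = m * 2 powr (- \<alpha>) * (1 / b) powr (\<alpha> * \<beta>)"
  have d: "d > 0" using m_pos b by (simp add: d_def)
  then show "pi * d\<^sup>2 > 0" by simp
  have "filterlim (\<lambda>\<epsilon>. (\<epsilon> / b) powr (- \<beta>)) at_top (at_right 0)"
    using b \<beta>(1) by real_asymp
  \<comment> \<open>The bound by \<open>a\<close> places \<open>\<Phi>\<close> in the domain; the
    bound by \<open>2 * pi\<close> gives \<open>\<Phi> + 2 * pi \<le> 2 * \<Phi>\<close>.\<close>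
  then have "eventually (\<lambda>\<epsilon>. max a (2 * pi) \<le> (\<epsilon> / b) powr (- \<beta>)) (at_right 0)"
    by (auto simp: filterlim_at_top eventually_conj_iff)
  moreover have "eventually (\<lambda>\<epsilon>::real. \<epsilon> > 0) (at_right 0)" by (rule eventually_at_right_less)
  ultimately show "eventually (\<lambda>\<epsilon>. pi * d\<^sup>2 * \<epsilon> powr (2 * \<alpha> / (1 + \<alpha>))
      \<le> measure lebesgue (eps_nbhd \<Gamma> \<epsilon>)) (at_right 0)"
  proof eventually_elim
    case (elim \<epsilon>)
    \<comment> \<open>This \<open>\<Phi>\<close> solves
      \<open>2 * pi * K * \<Phi> powr (- \<alpha> - 1) = \<epsilon>\<close>, so the turns beyond it
      are just close enough.\<close>
    define \<Phi> where "\<Phi> = (\<epsilon> / b) powr (- \<beta>)"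
    have \<Phi>: "a \<le> \<Phi>" "2 * pi \<le> \<Phi>" "\<Phi> > 0" using elim a_pos by (auto simp: \<Phi>_def)
    let ?R = "f (\<Phi> + 2 * pi)"
    have "- \<beta> * (- \<alpha> - 1) = 1" using \<beta>(2) by (simp add: algebra_simps)
    then have "\<Phi> powr (- \<alpha> - 1) = \<epsilon> / b"
      unfolding \<Phi>_def powr_powr using elim b by simp
    then have sub: "cball 0 ?R \<subseteq> eps_nbhd \<Gamma> \<epsilon>"
      using elim \<Phi> b by (intro cball_subset_eps_nbhd) (auto simp: b_def)
    have "d * \<epsilon> powr (\<alpha> * \<beta>) = m * (2 * \<Phi>) powr (- \<alpha>)"
      using elim b by (simp add: d_def \<Phi>_def powr_mult powr_powr powr_divide mult.commute)
    also have "\<dots> \<le> m * (\<Phi> + 2 * pi) powr (- \<alpha>)"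
      using \<Phi> m_pos \<alpha>_pos pi_gt_zero by (intro mult_left_mono powr_mono2'; linarith)
    also have "\<dots> \<le> ?R" using \<Phi> by (intro f_ge) (simp add: add_increasing2)
    finally have R: "d * \<epsilon> powr (\<alpha> * \<beta>) \<le> ?R" .
    have "d\<^sup>2 * \<epsilon> powr (2 * \<alpha> / (1 + \<alpha>)) = (d * \<epsilon> powr (\<alpha> * \<beta>))\<^sup>2"
      using elim by (simp add: power_mult_distrib \<beta>_def powr_add[symmetric] power2_eq_square add_divide_distrib[symmetric])
    also have "\<dots> \<le> ?R\<^sup>2" using R d by (intro power_mono) auto
    finally have "pi * d\<^sup>2 * \<epsilon> powr (2 * \<alpha> / (1 + \<alpha>)) \<le> pi * ?R\<^sup>2" by (simp add: mult.assoc)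
    also have "\<dots> = measure lebesgue (cball (0 :: real \<times> real) ?R)"
      using f_pos[of "\<Phi> + 2 * pi"] \<Phi> by (simp add: content_cball_plane add_increasing2 less_imp_le)
    also have "\<dots> \<le> measure lebesgue (eps_nbhd \<Gamma> \<epsilon>)"
      using sub elim bounded_\<Gamma> by (intro measure_mono_fmeasurable lmeasurable_eps_nbhd) auto
    finally show ?case .
  qed
qed

section \<open>Upper bound on the area\<close>

text \<open>The curve is Lipschitz in the parameter \<open>\<phi> powr (1 - \<alpha>)\<close>, which grows like its arc length.\<close>

lemma spiral_Lipschitz:
  obtains C where "C > 0"
    "\<And>x y. a \<le> x \<Longrightarrow> a \<le> y \<Longrightarrow> dist (spiral f x) (spiral f y) \<le> C * \<bar>x powr (1 - \<alpha>) - y powr (1 - \<alpha>)\<bar>"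
proof
  \<comment> \<open>The numerator bounds the speed relative to \<open>x powr (- \<alpha>)\<close>;
    the denominator cancels the factor from differentiating \<open>x powr (1 - \<alpha>)\<close>.
    The final constant is \<open>2 * C\<close> because each coordinate contributes
    \<open>C\<close>.\<close>
  define C where "C = (K / a + K / \<alpha>) / (1 - \<alpha>)"
  have C: "C > 0" using K_pos a_pos \<alpha>_pos \<alpha>_less by (simp add: C_def add_pos_pos)
  then show "2 * C > 0" by simp
  let ?h = "\<lambda>x. C * x powr (1 - \<alpha>)"
  have h: "(?h has_real_derivative C * ((1 - \<alpha>) * x powr (1 - \<alpha> - 1))) (at x within {a..})" if "x \<ge> a" for x
    using that by (intro DERIV_cmult deriv_powr)
  have speed: "\<bar>f' x\<bar> + \<bar>f x\<bar> \<le> C * ((1 - \<alpha>) * x powr (1 - \<alpha> - 1))" if "x \<ge> a" for x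
  proof -
    \<comment> \<open>Since \<open>x \<ge> a\<close>, the faster decaying bound for
      \<open>f'\<close> is absorbed into the order of \<open>f\<close>, at the cost of a factor
      \<open>1 / a\<close>.\<close>
    have "x powr (- \<alpha> - 1) = x powr (- \<alpha>) / x" using that a_pos by (simp add: powr_diff)
    also have "\<dots> \<le> x powr (- \<alpha>) / a" using that a_pos by (intro divide_left_mono) auto
    finally have "K * x powr (- \<alpha> - 1) \<le> K / a * x powr (- \<alpha>)"
      using mult_left_mono[of _ _ K] K_pos by fastforce
    then have "\<bar>f' x\<bar> + \<bar>f x\<bar> \<le> (K / a + K / \<alpha>) * x powr (- \<alpha>)"
      using f'_ge[OF that] f'_le[OF that] f_le[OF that] f_pos[OF that]
      unfolding distrib_right by linarith
    then show ?thesis using \<alpha>_less by (simp add: C_def)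
  qed
  have trig: "\<bar>u * s + v * t\<bar> \<le> \<bar>u\<bar> + \<bar>v\<bar>" if "\<bar>s\<bar> \<le> 1" "\<bar>t\<bar> \<le> 1" for u v s t :: real
    using mult_left_mono[OF that(1), of "\<bar>u\<bar>"] mult_left_mono[OF that(2), of "\<bar>v\<bar>"]
    by (simp add: abs_mult[symmetric])
  have ordered: "dist (spiral f x) (spiral f y) \<le> 2 * C * \<bar>x powr (1 - \<alpha>) - y powr (1 - \<alpha>)\<bar>"
    if xy: "a \<le> x" "x \<le> y" for x y
  proof -
    have "\<bar>f y * cos y - f x * cos x\<bar> \<le> ?h y - ?h x"
    proof (rule has_derivative_abs_le_imp_abs_diff_le[OF _ h _ xy, where g' = "\<lambda>x. f' x * cos x + f x * (- sin x)"])
      show "\<bar>f' x * cos x + f x * (- sin x)\<bar> \<le> C * ((1 - \<alpha>) * x powr (1 - \<alpha> - 1))" if "x \<ge> a" for x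
        using trig[of "cos x" "- sin x" "f' x" "f x"] speed[OF that] by simp
    qed (auto intro!: derivative_eq_intros deriv)
    moreover have "\<bar>f y * sin y - f x * sin x\<bar> \<le> ?h y - ?h x"
    proof (rule has_derivative_abs_le_imp_abs_diff_le[OF _ h _ xy, where g' = "\<lambda>x. f' x * sin x + f x * cos x"])
      show "\<bar>f' x * sin x + f x * cos x\<bar> \<le> C * ((1 - \<alpha>) * x powr (1 - \<alpha> - 1))" if "x \<ge> a" for x
        using trig[of "sin x" "cos x" "f' x" "f x"] speed[OF that] by simp
    qed (auto intro!: derivative_eq_intros deriv)
    moreover have "dist (spiral f x) (spiral f y) \<le> \<bar>f y * cos y - f x * cos x\<bar> + \<bar>f y * sin y - f x * sin x\<bar>"
      unfolding spiral_def dist_Pair_Pair dist_real_def power2_abs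
      using sqrt_sum_squares_le_sum_abs by (metis abs_minus_commute power2_abs)
    ultimately have "dist (spiral f x) (spiral f y) \<le> 2 * C * (y powr (1 - \<alpha>) - x powr (1 - \<alpha>))"
      by (simp add: algebra_simps)
    also have "\<dots> \<le> 2 * C * \<bar>x powr (1 - \<alpha>) - y powr (1 - \<alpha>)\<bar>"
      using C by (intro mult_left_mono) auto
    finally show ?thesis .
  qed
  show "dist (spiral f x) (spiral f y) \<le> 2 * C * \<bar>x powr (1 - \<alpha>) - y powr (1 - \<alpha>)\<bar>"
    if "a \<le> x" "a \<le> y" for x y
    using ordered[of x y] ordered[of y x] that by (cases "x \<le> y") (auto simp: dist_commute abs_minus_commute)
qed

text \<open>Curve points beyond \<open>\<Phi>\<close> lie in a central disc by \<open>f_le\<close>.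
  The earlier arc is sampled at steps of \<open>\<epsilon>\<close> in the parameter
  \<open>\<phi> powr (1 - \<alpha>)\<close>, so each of its points is within
  \<open>C * \<epsilon>\<close> of a sample; the additional \<open>2 * \<epsilon>\<close> in both
  radii comes from \<open>eps_nbhdE\<close>.\<close>

lemma eps_nbhd_subset:
  assumes Lip: "\<And>x y. a \<le> x \<Longrightarrow> a \<le> y \<Longrightarrow>
      dist (spiral f x) (spiral f y) \<le> C * \<bar>x powr (1 - \<alpha>) - y powr (1 - \<alpha>)\<bar>"
    and C: "C > 0" and \<epsilon>: "\<epsilon> > 0" and \<Phi>: "\<Phi> > 0"
  obtains q :: "nat \<Rightarrow> real \<times> real" where
    "eps_nbhd \<Gamma> \<epsilon> \<subseteq> cball 0 (K / \<alpha> * \<Phi> powr (- \<alpha>) + 2 * \<epsilon>) \<union>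
      (\<Union>k\<in>{..nat \<lfloor>\<Phi> powr (1 - \<alpha>) / \<epsilon>\<rfloor>}. cball (q k) ((C + 2) * \<epsilon>))"
proof
  \<comment> \<open>The outer power inverts the parameter change, so that the samples start at the
    angle \<open>a\<close> and are equally spaced in the new parameter.\<close>
  define s where "s k = (a powr (1 - \<alpha>) + real k * \<epsilon>) powr (1 / (1 - \<alpha>))" for k
  have s_powr: "s k powr (1 - \<alpha>) = a powr (1 - \<alpha>) + real k * \<epsilon>" for k
    using \<alpha>_less \<epsilon> by (simp add: s_def powr_powr)
  have s_ge: "a \<le> s k" for k
  proof -
    have "a = (a powr (1 - \<alpha>)) powr (1 / (1 - \<alpha>))" using \<alpha>_less a_pos by (simp add: powr_powr)
    also have "\<dots> \<le> s k" unfolding s_def using \<epsilon> \<alpha>_less by (intro powr_mono2) auto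
    finally show ?thesis .
  qed
  show "eps_nbhd \<Gamma> \<epsilon> \<subseteq> cball 0 (K / \<alpha> * \<Phi> powr (- \<alpha>) + 2 * \<epsilon>) \<union>
      (\<Union>k\<in>{..nat \<lfloor>\<Phi> powr (1 - \<alpha>) / \<epsilon>\<rfloor>}. cball (spiral f (s k)) ((C + 2) * \<epsilon>))"
  proof
    fix p assume "p \<in> eps_nbhd \<Gamma> \<epsilon>"
    then obtain \<phi> where \<phi>: "a \<le> \<phi>" and p: "dist p (spiral f \<phi>) \<le> 2 * \<epsilon>"
      using \<epsilon> by (elim eps_nbhdE) auto
    show "p \<in> cball 0 (K / \<alpha> * \<Phi> powr (- \<alpha>) + 2 * \<epsilon>) \<union>
      (\<Union>k\<in>{..nat \<lfloor>\<Phi> powr (1 - \<alpha>) / \<epsilon>\<rfloor>}. cball (spiral f (s k)) ((C + 2) * \<epsilon>))"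
    proof (cases "\<Phi> \<le> \<phi>")
      case True
      have "f \<phi> \<le> K / \<alpha> * \<phi> powr (- \<alpha>)" using \<phi> by (rule f_le)
      also have "\<dots> \<le> K / \<alpha> * \<Phi> powr (- \<alpha>)"
        using True \<Phi> K_pos \<alpha>_pos by (intro mult_left_mono powr_mono2') auto
      finally have "norm (spiral f \<phi>) \<le> K / \<alpha> * \<Phi> powr (- \<alpha>)"
        using f_pos[OF \<phi>] by (simp add: norm_spiral)
      then have "norm p \<le> K / \<alpha> * \<Phi> powr (- \<alpha>) + 2 * \<epsilon>"
        using p norm_triangle_sub[of p "spiral f \<phi>"] by (simp add: dist_norm)
      then show ?thesis by simp
    next
      case False
      \<comment> \<open>Here \<open>u\<close> is the position of \<open>\<phi>\<close> in units of
        the sampling step; rounding it down selects the sample.\<close>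
      define u where "u = (\<phi> powr (1 - \<alpha>) - a powr (1 - \<alpha>)) / \<epsilon>"
      define k where "k = nat \<lfloor>u\<rfloor>"
      have "a powr (1 - \<alpha>) \<le> \<phi> powr (1 - \<alpha>)" using \<phi> a_pos \<alpha>_less by (intro powr_mono2) auto
      then have u: "u \<ge> 0" using \<epsilon> by (simp add: u_def)
      have "\<phi> powr (1 - \<alpha>) \<le> \<Phi> powr (1 - \<alpha>)"
        using False \<phi> a_pos \<alpha>_less by (intro powr_mono2) auto
      then have "\<phi> powr (1 - \<alpha>) - a powr (1 - \<alpha>) \<le> \<Phi> powr (1 - \<alpha>)"
        using powr_ge_zero[of a "1 - \<alpha>"] by linarith
      then have "u \<le> \<Phi> powr (1 - \<alpha>) / \<epsilon>" unfolding u_def using \<epsilon> by (intro divide_right_mono) auto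
      then have k_le: "k \<le> nat \<lfloor>\<Phi> powr (1 - \<alpha>) / \<epsilon>\<rfloor>" unfolding k_def by (intro nat_mono floor_mono)
      have "\<bar>u - real k\<bar> \<le> 1" using u unfolding k_def by linarith
      then have "\<epsilon> * \<bar>u - real k\<bar> \<le> \<epsilon>" using \<epsilon> by simp
      moreover have "\<phi> powr (1 - \<alpha>) - s k powr (1 - \<alpha>) = \<epsilon> * (u - real k)"
        using \<epsilon> by (simp add: s_powr u_def field_simps)
      ultimately have "\<bar>\<phi> powr (1 - \<alpha>) - s k powr (1 - \<alpha>)\<bar> \<le> \<epsilon>"
        using \<epsilon> by (simp add: abs_mult)
      then have "C * \<bar>\<phi> powr (1 - \<alpha>) - s k powr (1 - \<alpha>)\<bar> \<le> C * \<epsilon>" using C by simp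
      then have "dist (spiral f \<phi>) (spiral f (s k)) \<le> C * \<epsilon>" using Lip[OF \<phi> s_ge[of k]] by linarith
      then have "dist p (spiral f (s k)) \<le> (C + 2) * \<epsilon>"
        using p dist_triangle[of p "spiral f (s k)" "spiral f \<phi>"] by (simp add: algebra_simps)
      then show ?thesis using k_le by (auto simp: dist_commute)
    qed
  qed
qed

text \<open>With \<open>\<Phi> = \<epsilon> powr (- 1 / (1 + \<alpha>))\<close> the two parts of the
  cover balance: the central disc has radius of order \<open>E\<close>, and about
  \<open>\<Phi> powr (1 - \<alpha>) / \<epsilon>\<close> small discs of area of order
  \<open>\<epsilon>\<^sup>2\<close> have total area of order \<open>E\<^sup>2\<close>.\<close>

lemma measure_upper:
  obtains c where "c > 0"
    "eventually (\<lambda>\<epsilon>. measure lebesgue (eps_nbhd \<Gamma> \<epsilon>) \<le> c * \<epsilon> powr (2 * \<alpha> / (1 + \<alpha>))) (at_right 0)"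
proof -
  obtain C where C: "C > 0" and Lip: "\<And>x y. a \<le> x \<Longrightarrow> a \<le> y \<Longrightarrow>
      dist (spiral f x) (spiral f y) \<le> C * \<bar>x powr (1 - \<alpha>) - y powr (1 - \<alpha>)\<bar>"
    using spiral_Lipschitz by blast
  define M where "M = K / \<alpha>"
  have M: "M > 0" using K_pos \<alpha>_pos by (simp add: M_def)
  \<comment> \<open>The first summand bounds the central disc, using
    \<open>\<epsilon> \<le> E\<close>. The 2 in the second covers
    \<open>N * \<epsilon>\<^sup>2 \<le> E\<^sup>2\<close> and the one extra disc, as there are
    \<open>N + 1\<close> samples.\<close>
  define c where "c = pi * ((M + 2)\<^sup>2 + 2 * (C + 2)\<^sup>2)"
  have "c > 0" using M C by (auto simp: c_def intro!: mult_pos_pos add_pos_pos)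
  have "eventually (\<lambda>\<epsilon>::real. 0 < \<epsilon> \<and> \<epsilon> < 1) (at_right 0)"
    using eventually_at_right_field[of "\<lambda>\<epsilon>::real. 0 < \<epsilon> \<and> \<epsilon> < 1" 0] zero_less_one by blast
  then have "eventually (\<lambda>\<epsilon>. measure lebesgue (eps_nbhd \<Gamma> \<epsilon>) \<le> c * \<epsilon> powr (2 * \<alpha> / (1 + \<alpha>))) (at_right 0)"
  proof eventually_elim
    case (elim \<epsilon>)
    then have \<epsilon>: "\<epsilon> > 0" by simp
    define \<Phi> where "\<Phi> = \<epsilon> powr (- 1 / (1 + \<alpha>))"
    have \<Phi>: "\<Phi> > 0" using \<epsilon> by (simp add: \<Phi>_def)
    define E where "E = \<epsilon> powr (\<alpha> / (1 + \<alpha>))"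
    have E2: "\<epsilon> powr (2 * \<alpha> / (1 + \<alpha>)) = E\<^sup>2"
      by (simp add: E_def power2_eq_square powr_add[symmetric] add_divide_distrib[symmetric])
    have tail: "\<Phi> powr (- \<alpha>) = E" using \<alpha>_pos by (simp add: \<Phi>_def E_def powr_powr)
    have "\<Phi> powr (1 - \<alpha>) * \<epsilon> = \<epsilon> powr (- 1 / (1 + \<alpha>) * (1 - \<alpha>) + 1)"
      unfolding \<Phi>_def powr_powr powr_add using \<epsilon> by simp
    also have "- 1 / (1 + \<alpha>) * (1 - \<alpha>) + 1 = 2 * \<alpha> / (1 + \<alpha>)"
      using \<alpha>_pos by (simp add: field_simps)
    finally have arc: "\<Phi> powr (1 - \<alpha>) * \<epsilon> = E\<^sup>2" by (simp add: E2)
    \<comment> \<open>For \<open>\<epsilon> < 1\<close> the smaller exponent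
      \<open>\<alpha> / (1 + \<alpha>)\<close> gives the larger power.\<close>
    have "\<epsilon> powr 1 \<le> E" unfolding E_def using elim \<alpha>_pos by (intro powr_mono') auto
    then have \<epsilon>_le: "\<epsilon> \<le> E" using \<epsilon> by simp
    define N where "N = nat \<lfloor>\<Phi> powr (1 - \<alpha>) / \<epsilon>\<rfloor>"
    have N: "real N \<le> \<Phi> powr (1 - \<alpha>) / \<epsilon>" unfolding N_def using \<epsilon> by simp
    obtain q where sub: "eps_nbhd \<Gamma> \<epsilon> \<subseteq> cball 0 (M * E + 2 * \<epsilon>) \<union> (\<Union>k\<in>{..N}. cball (q k) ((C + 2) * \<epsilon>))"
      using eps_nbhd_subset[OF Lip C \<epsilon> \<Phi>] unfolding N_def M_def tail by blast
    have cball_meas: "cball x r \<in> lmeasurable" for x :: "real \<times> real" and r by (rule lmeasurable_cball)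
    have "measure lebesgue (eps_nbhd \<Gamma> \<epsilon>)
        \<le> measure lebesgue (cball (0 :: real \<times> real) (M * E + 2 * \<epsilon>) \<union> (\<Union>k\<in>{..N}. cball (q k) ((C + 2) * \<epsilon>)))"
      using sub closed_eps_nbhd
      by (intro measure_mono_fmeasurable fmeasurable.Un fmeasurable.finite_UN cball_meas) auto
    also have "\<dots> \<le> measure lebesgue (cball (0 :: real \<times> real) (M * E + 2 * \<epsilon>))
        + measure lebesgue (\<Union>k\<in>{..N}. cball (q k) ((C + 2) * \<epsilon>))"
      by (intro measure_Un_le) auto
    also have "\<dots> \<le> measure lebesgue (cball (0 :: real \<times> real) (M * E + 2 * \<epsilon>))
        + (\<Sum>k\<in>{..N}. measure lebesgue (cball (q k) ((C + 2) * \<epsilon>)))"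
      by (intro add_left_mono measure_UNION_le) auto
    also have "\<dots> = pi * (M * E + 2 * \<epsilon>)\<^sup>2 + (real N + 1) * (pi * ((C + 2) * \<epsilon>)\<^sup>2)"
    proof -
      have "M * E + 2 * \<epsilon> \<ge> 0" "(C + 2) * \<epsilon> \<ge> 0" using \<epsilon> M C by (simp_all add: E_def)
      then show ?thesis by (simp add: content_cball_plane)
    qed
    also have "\<dots> \<le> pi * ((M + 2) * E)\<^sup>2 + (pi * (C + 2)\<^sup>2) * (2 * E\<^sup>2)"
    proof (intro add_mono mult_left_mono power_mono)
      have "real N * \<epsilon>\<^sup>2 \<le> \<Phi> powr (1 - \<alpha>) / \<epsilon> * \<epsilon>\<^sup>2" using N by (intro mult_right_mono) auto
      also have "\<dots> = E\<^sup>2" using arc \<epsilon> by (simp add: power2_eq_square)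
      finally have "(real N + 1) * \<epsilon>\<^sup>2 \<le> 2 * E\<^sup>2"
        using power_mono[OF \<epsilon>_le, of 2] \<epsilon> by (simp add: algebra_simps)
      then have "(pi * (C + 2)\<^sup>2) * ((real N + 1) * \<epsilon>\<^sup>2) \<le> (pi * (C + 2)\<^sup>2) * (2 * E\<^sup>2)"
        by (intro mult_left_mono) auto
      then show "(real N + 1) * (pi * ((C + 2) * \<epsilon>)\<^sup>2) \<le> (pi * (C + 2)\<^sup>2) * (2 * E\<^sup>2)"
        by (simp add: power_mult_distrib mult_ac)
    qed (use \<epsilon>_le \<epsilon> M in \<open>auto simp: algebra_simps E_def\<close>)
    also have "\<dots> = c * E\<^sup>2" unfolding c_def power_mult_distrib by (simp add: algebra_simps)
    finally show ?case unfolding E2 .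
  qed
  then show ?thesis using that \<open>c > 0\<close> by blast
qed

section \<open>The dimension of the spiral\<close>

lemma has_box_dim: "has_box_dim \<Gamma> (2 / (1 + \<alpha>))"
proof -
  obtain c\<^sub>1 where "c\<^sub>1 > 0"
    "eventually (\<lambda>\<epsilon>. c\<^sub>1 * \<epsilon> powr (2 * \<alpha> / (1 + \<alpha>)) \<le> measure lebesgue (eps_nbhd \<Gamma> \<epsilon>)) (at_right 0)"
    by (rule measure_lower)
  moreover obtain c\<^sub>2 where "c\<^sub>2 > 0"
    "eventually (\<lambda>\<epsilon>. measure lebesgue (eps_nbhd \<Gamma> \<epsilon>) \<le> c\<^sub>2 * \<epsilon> powr (2 * \<alpha> / (1 + \<alpha>))) (at_right 0)"
    by (rule measure_upper)
  ultimately have "has_box_dim \<Gamma> (2 - 2 * \<alpha> / (1 + \<alpha>))"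
    using bounded_\<Gamma> by (intro has_box_dimI) auto
  moreover have "2 - 2 * \<alpha> / (1 + \<alpha>) = 2 / (1 + \<alpha>)" using \<alpha>_pos by (simp add: field_simps)
  ultimately show ?thesis by simp
qed

end

theorem corollary1p1:
  fixes f f' :: "real \<Rightarrow> real" and \<phi>\<^sub>1 m K \<alpha> :: real
  assumes "\<phi>\<^sub>1 > 0"
    and "\<And>\<phi>. \<phi> \<ge> \<phi>\<^sub>1 \<Longrightarrow> (f has_real_derivative f' \<phi>) (at \<phi> within {\<phi>\<^sub>1..})"
    and "continuous_on {\<phi>\<^sub>1..} f'"
    and "(f \<longlongrightarrow> 0) at_top"
    and "m > 0" and "K > 0" and "0 < \<alpha>" and "\<alpha> < 1"
    and "\<And>\<phi>. \<phi> \<ge> \<phi>\<^sub>1 \<Longrightarrow> m * \<phi> powr (- \<alpha>) \<le> f \<phi>"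
    and "\<And>\<phi>. \<phi> \<ge> \<phi>\<^sub>1 \<Longrightarrow> - K * \<phi> powr (- \<alpha> - 1) \<le> f' \<phi> \<and> f' \<phi> \<le> 0"
    and "\<And>\<phi>. \<phi> \<ge> \<phi>\<^sub>1 \<Longrightarrow> \<exists>\<psi>\<in>{\<phi>..<\<phi> + 2 * pi}. f' \<psi> \<noteq> 0"
  shows "has_box_dim {(f \<phi> * cos \<phi>, f \<phi> * sin \<phi>) | \<phi>. \<phi> \<ge> \<phi>\<^sub>1} (2 / (1 + \<alpha>))"
proof -
  interpret power_spiral f f' \<phi>\<^sub>1 m K \<alpha>
    using assms by unfold_locales auto
  have "{(f \<phi> * cos \<phi>, f \<phi> * sin \<phi>) | \<phi>. \<phi> \<ge> \<phi>\<^sub>1} = \<Gamma>"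
    by (auto simp: spiral_def)
  then show ?thesis using has_box_dim by simp
qed

end
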